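(* For every constant $\ell$ there exist constants $C,c>0$ and $n_0$ such that for all $n\geq n_0$ and all $k$ the following holds. Let $\mathbf{c}=(c_1,\dots,c_k)$ be any initial $k$-color configuration on $n$ nodes (with $c_1\geq c_2\geq\dots\geq c_k$) such that $c_1\geq n/\log^{\ell} n$ and $s(\mathbf{c})=c_1-c_2\geq 22\sqrt{n\log^{\ell+1}n}$. Then, with probability at least $1-n^{-c}$, the 3-majority protocol started from $\mathbf{c}$ reaches the configuration in which all $n$ nodes have the plurality color $1$ within at most $C\log^{\ell+1}n$ rounds.
   Context: A $k$-color configuration on $n$ nodes is a $k$-tuple $\mathbf{c}=(c_1,\dots,c_k)$ of non-negative integers with $\sum_{j} c_j = n$, where $c_j$ is the number of nodes with color $j\in[k]=\{1,\dots,k\}$. Colors are indexed so that in the initial configuration $c_1\geq c_2\geq\dots\geq c_k$; color $1$ is the plurality color and $s(\mathbf{c})=c_1-c_2$ is the bias. 3-majority protocol (on the clique, synchronous rounds): at every round, every node, independently of the others, picks three nodes uniformly at random (including itself and with repetitions) and recolors itself according to the majority of the colors it sees; if it sees three different colors, it chooses the first one. All nodes update simultaneously, using the colors at the beginning of the round. $\log$ is the natural logarithm, and $\log^{a} n$ means $(\log n)^a$. *)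

theory Defs
  imports "HOL-Probability.Probability"
begin

text \<open>
  The nodes are \<open>{..<n}\<close> and the colors of a \<open>k\<close>-color configuration are \<open>{1..k}\<close>.
  A \<open>k\<close>-tuple is extended by \<open>0\<close> outside \<open>{1..k}\<close>; in particular \<open>c 2 = 0\<close> if \<open>k = 1\<close>,
  so that the bias \<open>c 1 - c 2\<close> is meaningful for every \<open>k\<close>.
\<close>

definition configuration :: "nat \<Rightarrow> nat \<Rightarrow> (nat \<Rightarrow> nat) \<Rightarrow> bool" where
  "configuration k n c \<longleftrightarrow> (\<forall>j. j \<notin> {1..k} \<longrightarrow> c j = 0) \<and> (\<Sum>j=1..k. c j) = n"

definition color_sorted :: "nat \<Rightarrow> (nat \<Rightarrow> nat) \<Rightarrow> bool" where
  "color_sorted k c \<longleftrightarrow> (\<forall>i\<in>{1..k}. \<forall>j\<in>{1..k}. i \<le> j \<longrightarrow> c j \<le> c i)"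

definition bias :: "(nat \<Rightarrow> nat) \<Rightarrow> int" where
  "bias c = int (c 1) - int (c 2)"

text \<open>A coloring \<open>x\<close> assigns colors to nodes; only its values on \<open>{..<n}\<close> matter.\<close>

definition color_count :: "nat \<Rightarrow> (nat \<Rightarrow> nat) \<Rightarrow> nat \<Rightarrow> nat" where
  "color_count n x j = card {v. v < n \<and> x v = j}"

definition maj3 :: "'a \<Rightarrow> 'a \<Rightarrow> 'a \<Rightarrow> 'a" where
  "maj3 a b d = (if a = b \<or> a = d then a else if b = d then b else a)"

definition node_update :: "nat \<Rightarrow> (nat \<Rightarrow> nat) \<Rightarrow> nat pmf" where
  "node_update n x = do {
     u \<leftarrow> pmf_of_set {..<n};
     v \<leftarrow> pmf_of_set {..<n};
     w \<leftarrow> pmf_of_set {..<n};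
     return_pmf (maj3 (x u) (x v) (x w))
   }"

text \<open>All nodes update independently, each of them reading the old coloring \<open>x\<close>.\<close>

definition majority_round :: "nat \<Rightarrow> (nat \<Rightarrow> nat) \<Rightarrow> (nat \<Rightarrow> nat) pmf" where
  "majority_round n x = Pi_pmf {..<n} 0 (\<lambda>_. node_update n x)"

text \<open>
  Law of the trajectory \<open>[X\<^sub>0, \<dots>, X\<^sub>T]\<close> of the Markov chain of colorings with \<open>X\<^sub>0 = x\<close>.
\<close>

primrec trajectory :: "nat \<Rightarrow> nat \<Rightarrow> (nat \<Rightarrow> nat) \<Rightarrow> (nat \<Rightarrow> nat) list pmf" where
  "trajectory n 0 x = return_pmf [x]"
| "trajectory n (Suc T) x =
     bind_pmf (majority_round n x) (\<lambda>y. map_pmf ((#) x) (trajectory n T y))"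

definition all_color :: "nat \<Rightarrow> nat \<Rightarrow> (nat \<Rightarrow> nat) \<Rightarrow> bool" where
  "all_color n j x \<longleftrightarrow> (\<forall>v<n. x v = j)"

definition prob_reach_within :: "nat \<Rightarrow> nat \<Rightarrow> nat \<Rightarrow> (nat \<Rightarrow> nat) \<Rightarrow> real" where
  "prob_reach_within n j T x =
     measure_pmf.prob (trajectory n T x) {xs. \<exists>t\<le>T. all_color n j (xs ! t)}"

end

theory Submission imports Defs "HOL-Real_Asymp.Real_Asymp" begin

text \<open>
  Write \<open>p\<^sub>j\<close> for the fraction of nodes of color \<open>j\<close>, \<open>P\<close> for that of the plurality color and
  \<open>q = (\<Sum>j. p\<^sub>j\<^sup>2)\<close>. A node gets color \<open>j\<close> with probability \<open>p\<^sub>j (1 + p\<^sub>j - q)\<close>. If \<open>P\<close>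
  exceeds every other \<open>p\<^sub>j\<close> by at least \<open>d\<close>, then \<open>q \<le> P - d (1 - P)\<close>, so the expected gap after
  one round is at least \<open>d (1 + P (1 - P))\<close>. As long as \<open>P < 2/3\<close> this drift exceeds
  the fluctuations, which are of order \<open>sqrt (P log n / n)\<close> by a Chernoff bound that
  depends on the variance (Hoeffding's inequality would lose the factor \<open>sqrt P\<close>). So with high
  probability \<open>P\<close> does not decrease and \<open>d\<close> grows by a factor \<open>1 + \<Omega>(1 / log\<^sup>l n)\<close> in each
  round; since \<open>d \<le> 1\<close>, this forces \<open>P \<ge> 2/3\<close> after \<open>O(log\<^sup>l\<^sup>+\<^sup>1 n)\<close> rounds. From then on the
  fraction \<open>1 - P\<close> of the other nodes shrinks in expectation by the factor \<open>7/9\<close>, and Markov's inequality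
  shows that it vanishes after \<open>O(log n)\<close> further rounds.
\<close>

section \<open>Chernoff bound in terms of the second moment\<close>

text \<open>For negative \<open>y = - z\<close>, the product of \<open>1 - z + z\<^sup>2\<close>
  with the quadratic Taylor lower bound of \<open>exp z\<close> is at least 1; taking reciprocals
  gives the claim.\<close>

lemma exp_le_quadratic:
  fixes y :: real
  assumes "\<bar>y\<bar> \<le> 1"
  shows "exp y \<le> 1 + y + y\<^sup>2"
proof (cases "y \<ge> 0")
  case True
  then show ?thesis using exp_bound assms by auto
next
  case False
  define z where "z = - y"
  have z: "0 \<le> z" "z \<le> 1" using False assms by (auto simp: z_def)
  have "1 \<le> (1 + z + z\<^sup>2 / 2) * (1 - z + z\<^sup>2)"
  proof -
    have "(1 + z + z\<^sup>2 / 2) * (1 - z + z\<^sup>2) = 1 + (z\<^sup>2 / 2 + z^3 / 2 + z^4 / 2)"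
      by (simp add: field_simps power2_eq_square power3_eq_cube power4_eq_xxxx)
    then show ?thesis using z by simp
  qed
  also have "\<dots> \<le> exp z * (1 - z + z\<^sup>2)"
    using exp_lower_Taylor_quadratic[OF z(1)] z
    by (intro mult_right_mono) (auto simp: power2_eq_square mult_left_le)
  finally have "exp (- z) \<le> 1 - z + z\<^sup>2"
    by (simp add: exp_minus divide_simps mult.commute)
  then show ?thesis by (simp add: z_def)
qed

text \<open>Exponential Markov inequality: independence factors the moment generating function, and
  \<open>exp_le_quadratic\<close> bounds each factor in terms of \<open>m\<close> and
  \<open>s\<close>. The upper bound on \<open>t\<close> keeps all exponents within [-1, 1].\<close>

lemma chernoff_Pi_pmf_lower:
  fixes p :: "'b pmf" and g :: "'b \<Rightarrow> real" and m s t :: real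
  assumes A: "finite A" and fin: "finite (set_pmf p)"
    and bnd: "\<And>v. \<bar>g v\<bar> \<le> 1"
    and m: "measure_pmf.expectation p g \<ge> m"
    and s: "measure_pmf.expectation p (\<lambda>v. (g v)\<^sup>2) \<le> s"
    and "s > 0" "t \<ge> 0" "t \<le> 2 * card A * s"
  shows "measure_pmf.prob (Pi_pmf A d (\<lambda>_. p)) {y. (\<Sum>v\<in>A. g (y v)) < card A * m - t}
           \<le> exp (- t\<^sup>2 / (4 * card A * s))"
proof (cases "A = {}")
  case True
  then show ?thesis by simp
next
  case False
  define a where "a = real (card A)"
  have a: "a > 0" using False A by (simp add: a_def card_gt_0_iff)
  \<comment> \<open>This \<open>l\<close> minimizes \<open>- l * t + a * l\<^sup>2 * s\<close>, the
    exponent that remains at the end.\<close>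
  define l where "l = t / (2 * a * s)"
  have l: "0 \<le> l" "l \<le> 1" using assms a by (auto simp: l_def a_def divide_simps)
  note int = integrable_measure_pmf_finite[OF fin]
  have "measure_pmf.expectation p (\<lambda>v. exp (- l * g v))
      \<le> measure_pmf.expectation p (\<lambda>v. 1 - l * g v + l\<^sup>2 * (g v)\<^sup>2)"
  proof (intro integral_mono int)
    fix v
    have "\<bar>- l * g v\<bar> \<le> 1" using l bnd[of v] by (simp add: abs_mult mult_le_one)
    from exp_le_quadratic[OF this] show "exp (- l * g v) \<le> 1 - l * g v + l\<^sup>2 * (g v)\<^sup>2"
      by (simp add: power_mult_distrib)
  qed
  also have "\<dots> = 1 - l * measure_pmf.expectation p g + l\<^sup>2 * measure_pmf.expectation p (\<lambda>v. (g v)\<^sup>2)"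
    by (simp add: int)
  also have "\<dots> \<le> 1 + (- l * m + l\<^sup>2 * s)"
    using mult_left_mono[OF m l(1)] mult_left_mono[OF s, of "l\<^sup>2"] by simp
  also have "\<dots> \<le> exp (- l * m + l\<^sup>2 * s)" by (rule exp_ge_add_one_self)
  finally have one: "measure_pmf.expectation p (\<lambda>v. exp (- l * g v)) \<le> exp (- l * m + l\<^sup>2 * s)" .
  let ?P = "Pi_pmf A d (\<lambda>_. p)"
  have fP: "finite (set_pmf ?P)"
    by (rule finite_subset[OF set_Pi_pmf_subset'[OF A]]) (auto intro!: A fin)
  let ?S = "{y. (\<Sum>v\<in>A. g (y v)) < a * m - t}"
  have "measure_pmf.prob ?P ?S = measure_pmf.expectation ?P (indicator ?S)" by simp
  also have "\<dots> \<le> measure_pmf.expectation ?P (\<lambda>y. exp (l * (a * m - t)) * (\<Prod>v\<in>A. exp (- l * g (y v))))"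
  proof (intro integral_mono integrable_measure_pmf_finite[OF fP])
    fix y
    have "1 \<le> exp (l * (a * m - t)) * (\<Prod>v\<in>A. exp (- l * g (y v)))" if "y \<in> ?S"
    proof -
      have "l * (\<Sum>v\<in>A. g (y v)) \<le> l * (a * m - t)" using that l by (intro mult_left_mono) auto
      then show ?thesis
        by (simp add: exp_sum[OF A, symmetric] exp_add[symmetric] sum_negf sum_distrib_left)
    qed
    then show "indicator ?S y \<le> exp (l * (a * m - t)) * (\<Prod>v\<in>A. exp (- l * g (y v)))"
      by (auto simp: indicator_def intro!: prod_nonneg mult_nonneg_nonneg)
  qed
  also have "\<dots> = exp (l * (a * m - t)) * (\<Prod>v\<in>A. measure_pmf.expectation p (\<lambda>v. exp (- l * g v)))"
    by (subst integral_mult_right_zero, subst expectation_prod_Pi_pmf) (auto intro: int A)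
  also have "\<dots> \<le> exp (l * (a * m - t)) * (\<Prod>v\<in>A. exp (- l * m + l\<^sup>2 * s))"
    by (intro mult_left_mono prod_mono conjI one) auto
  also have "\<dots> = exp (l * (a * m - t) + a * (- l * m + l\<^sup>2 * s))"
    by (simp only: prod_constant exp_add[of "l * (real (card A) * m - t)"] exp_of_nat_mult a_def)
  also have "l * (a * m - t) + a * (- l * m + l\<^sup>2 * s) = - t\<^sup>2 / (4 * a * s)"
    using a \<open>s > 0\<close> by (simp add: l_def field_simps power2_eq_square)
  finally show ?thesis by (simp add: a_def)
qed

section \<open>Law of the update of one node\<close>

definition color_frac :: "nat \<Rightarrow> (nat \<Rightarrow> nat) \<Rightarrow> nat \<Rightarrow> real" where
  "color_frac n x j = color_count n x j / n"

text \<open>The probability that two uniformly chosen nodes have the same color.\<close>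

definition agree :: "nat \<Rightarrow> (nat \<Rightarrow> nat) \<Rightarrow> real" where
  "agree n x = (\<Sum>v<n. color_frac n x (x v)) / n"

text \<open>If the last two samples disagree, the first one wins, either as part of a majority or by
  the tie-breaking rule.\<close>

lemma maj3_eq: "maj3 a b d = (if b = d then b else a)"
  by (auto simp: maj3_def)

lemma color_count_eq_sum: "real (color_count n x j) = (\<Sum>v<n. of_bool (x v = j))"
proof -
  have "(\<Sum>v<n. of_bool (x v = j)) = real (card ({..<n} \<inter> {v. x v = j}))"
    by (simp add: of_bool_def sum.If_cases)
  also have "{..<n} \<inter> {v. x v = j} = {v. v < n \<and> x v = j}" by auto
  finally show ?thesis by (simp add: color_count_def)
qed

text \<open>By \<open>maj3_eq\<close>, a node gets color \<open>j\<close> if its last two samples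
  both have color \<open>j\<close>, or if they disagree and the first has color \<open>j\<close>.
  For the fraction \<open>p\<close> of color \<open>j\<close> and \<open>q = agree n x\<close>,
  these events have probabilities \<open>p\<^sup>2\<close> and \<open>p * (1 - q)\<close>.\<close>

lemma pmf_node_update:
  assumes n: "n > 0"
  shows "pmf (node_update n x) j
    = color_frac n x j * (1 + color_frac n x j - agree n x)"
proof -
  have ne: "{..<n} \<noteq> {}" using n by auto
  let ?c = "\<lambda>j. real (color_count n x j)"
  let ?I = "\<lambda>v j. of_bool (x v = j) :: real"
  have "pmf (node_update n x) j
      = (\<Sum>u<n. \<Sum>v<n. \<Sum>w<n. of_bool (maj3 (x u) (x v) (x w) = j)) / real n ^ 3"
    unfolding node_update_def
    by (simp add: pmf_bind integral_pmf_of_set[OF ne] pmf_return indicator_def of_bool_def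
      sum_divide_distrib[symmetric] power3_eq_cube)
  \<comment> \<open>The third sample matters only through its agreement with the second, so it can
    be summed out first.\<close>
  also have "(\<Sum>u<n. \<Sum>v<n. \<Sum>w<n. of_bool (maj3 (x u) (x v) (x w) = j))
      = (\<Sum>u<n. \<Sum>v<n. \<Sum>w<n. ?I u j + ?I w (x v) * (?I v j - ?I u j))"
    by (intro sum.cong refl) (auto simp: maj3_eq)
  also have "\<dots> = (\<Sum>u<n. \<Sum>v<n. n * ?I u j + ?c (x v) * (?I v j - ?I u j))"
    by (simp only: sum.distrib sum_distrib_right[symmetric] sum_constant card_lessThan
      color_count_eq_sum[where x = x, symmetric])
  also have "\<dots> = (\<Sum>v<n. \<Sum>u<n. n * ?I u j + ?c (x v) * (?I v j - ?I u j))"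
    by (rule sum.swap)
  also have "\<dots> = (\<Sum>v<n. n * ?c j + ?c (x v) * (n * ?I v j - ?c j))"
    by (simp only: sum.distrib sum_distrib_left[symmetric] sum_subtractf sum_constant card_lessThan
      color_count_eq_sum[where x = x, symmetric])
  also have "\<dots> = (\<Sum>v<n. n * ?c j + (n * (?c j * ?I v j) - ?c (x v) * ?c j))"
    by (intro sum.cong) (auto simp: algebra_simps)
  also have "\<dots> = n * (n * ?c j) + (n * (?c j * ?c j) - (\<Sum>v<n. ?c (x v)) * ?c j)"
    by (simp add: sum.distrib sum_subtractf sum_distrib_left[symmetric] sum_distrib_right[symmetric]
      color_count_eq_sum[symmetric])
  also have "\<dots> / real n ^ 3 = ?c j / n * (1 + ?c j / n - (\<Sum>v<n. ?c (x v)) / n / n)"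
    using n by (simp add: power3_eq_cube add_divide_distrib diff_divide_distrib algebra_simps)
  finally show ?thesis by (simp add: color_frac_def agree_def sum_divide_distrib)
qed

lemma color_count_eq_sum_indicator:
  "real (color_count n x j) = (\<Sum>v<n. indicator {j} (x v))"
  unfolding color_count_eq_sum by (intro sum.cong) (auto simp: indicator_def)

lemma color_frac_nonneg: "color_frac n x j \<ge> 0"
  by (simp add: color_frac_def)

lemma color_frac_add_le:
  assumes "i \<noteq> j"
  shows "color_frac n x i + color_frac n x j \<le> 1"
proof (cases "n = 0")
  case False
  have "real (color_count n x i) + real (color_count n x j) \<le> (\<Sum>v<n. 1)"
    unfolding color_count_eq_sum sum.distrib[symmetric] using assms by (intro sum_mono) auto
  then show ?thesis using False by (simp add: color_frac_def field_simps)
qed (simp add: color_frac_def)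

lemma color_frac_le_1: "color_frac n x i \<le> 1"
  using color_frac_add_le[of i "Suc i" n x] color_frac_nonneg[of n x "Suc i"] by simp

text \<open>Two samples that both have color \<open>i\<close> are one way to agree.\<close>

lemma agree_ge: "agree n x \<ge> (color_frac n x i)\<^sup>2"
proof -
  have "(\<Sum>v<n. of_bool (x v = i) * color_frac n x i) \<le> (\<Sum>v<n. color_frac n x (x v))"
    by (intro sum_mono) (auto simp: color_frac_nonneg)
  then have "color_count n x i * color_frac n x i / n \<le> agree n x"
    unfolding agree_def sum_distrib_right[symmetric] color_count_eq_sum[symmetric]
    by (rule divide_right_mono) auto
  then show ?thesis by (simp add: color_frac_def power2_eq_square)
qed

text \<open>A node of color \<open>i\<close> contributes the fraction of that color to the average,
  every other node at most \<open>m\<close>.\<close>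

lemma agree_le:
  assumes n: "n > 0" and le: "\<And>j. j \<noteq> i \<Longrightarrow> color_frac n x j \<le> m"
  shows "agree n x \<le> (color_frac n x i)\<^sup>2 + m * (1 - color_frac n x i)"
proof -
  let ?P = "color_frac n x i"
  have "(\<Sum>v<n. color_frac n x (x v)) \<le> (\<Sum>v<n. m + of_bool (x v = i) * (?P - m))"
    by (intro sum_mono) (auto intro: le)
  also have "\<dots> = n * m + color_count n x i * (?P - m)"
    by (simp add: sum.distrib sum_distrib_right[symmetric] color_count_eq_sum)
  finally have "agree n x \<le> (n * m + color_count n x i * (?P - m)) / n"
    unfolding agree_def by (rule divide_right_mono) auto
  also have "\<dots> = m + ?P * (?P - m)"
    using n by (simp add: add_divide_distrib color_frac_def)
  finally show ?thesis by (simp add: algebra_simps power2_eq_square)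
qed

lemma agree_le_1:
  assumes "n > 0"
  shows "agree n x \<le> 1"
proof -
  have "(\<Sum>v<n. color_frac n x (x v)) \<le> (\<Sum>v<n. 1)"
    by (intro sum_mono color_frac_le_1)
  then show ?thesis using assms by (simp add: agree_def)
qed

section \<open>Support and concentration of one round\<close>

lemma set_pmf_node_update:
  assumes "n > 0"
  shows "set_pmf (node_update n x) \<subseteq> x ` {..<n}"
proof
  fix j assume "j \<in> set_pmf (node_update n x)"
  then have "color_frac n x j \<noteq> 0"
    by (auto simp: set_pmf_iff pmf_node_update[OF assms])
  then have "{v. v < n \<and> x v = j} \<noteq> {}"
    by (auto simp: color_frac_def color_count_def)
  then show "j \<in> x ` {..<n}" by auto
qed

lemma finite_set_pmf_node_update:
  assumes "n > 0"
  shows "finite (set_pmf (node_update n x))"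
  using finite_subset[OF set_pmf_node_update[OF assms]] by simp

lemma finite_set_pmf_majority_round: "finite (set_pmf (majority_round n x))"
proof (cases "n = 0")
  case False
  show ?thesis unfolding majority_round_def
    by (rule finite_subset[OF set_Pi_pmf_subset'])
      (use False in \<open>auto intro!: finite_set_pmf_node_update\<close>)
qed (simp add: majority_round_def)

lemma majority_round_color:
  assumes "n > 0" "y \<in> set_pmf (majority_round n x)" "v < n"
  shows "y v \<in> x ` {..<n}"
proof -
  have "y v \<in> set_pmf (node_update n x)"
    using assms by (auto simp: majority_round_def set_Pi_pmf PiE_dflt_def)
  then show ?thesis using set_pmf_node_update[OF assms(1)] by blast
qed

text \<open>An indicator is its own square, so the second moment is the probability of color
  \<open>i\<close> itself, and a small \<open>s\<close> sharpens the tail.\<close>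

lemma prob_color_frac_less:
  assumes n: "n > 0" and "m \<le> pmf (node_update n x) i" "pmf (node_update n x) i \<le> s"
    and "0 < s" "0 \<le> t" "t \<le> 2 * s"
  shows "measure_pmf.prob (majority_round n x) {y. color_frac n y i < m - t}
           \<le> exp (- (n * t\<^sup>2 / (4 * s)))"
proof -
  have sq: "(\<lambda>v. (indicator {i} v :: real)\<^sup>2) = indicator {i}"
    by (auto simp: indicator_def)
  have E: "measure_pmf.expectation (node_update n x) (indicator {i}) = pmf (node_update n x) i"
    by (simp add: measure_pmf_single)
  have "measure_pmf.prob (majority_round n x)
      {y. (\<Sum>v\<in>{..<n}. indicator {i} (y v)) < card {..<n} * m - n * t}
      \<le> exp (- (n * t)\<^sup>2 / (4 * card {..<n} * s))"
    unfolding majority_round_def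
  proof (rule chernoff_Pi_pmf_lower)
    show "m \<le> measure_pmf.expectation (node_update n x) (indicator {i})"
      unfolding E by (rule assms)
    show "measure_pmf.expectation (node_update n x) (\<lambda>v. (indicator {i} v)\<^sup>2) \<le> s"
      unfolding sq E by (rule assms)
  qed (use assms in \<open>auto simp: finite_set_pmf_node_update indicator_def\<close>)
  also have "{y. (\<Sum>v\<in>{..<n}. indicator {i} (y v)) < card {..<n} * m - n * t}
      = {y. color_frac n y i < m - t}"
    using n by (simp add: color_frac_def color_count_eq_sum_indicator[symmetric] field_simps)
  finally show ?thesis using n by (simp add: power2_eq_square mult_ac)
qed

text \<open>The two counts are dependent, but their difference is a sum of independent terms in {-1,
  0, 1}, each with square equal to the sum of the two indicators.\<close>

lemma prob_color_frac_diff_less: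
  assumes n: "n > 0" and ij: "i \<noteq> j"
    and "m \<le> pmf (node_update n x) i - pmf (node_update n x) j"
    and "pmf (node_update n x) i + pmf (node_update n x) j \<le> s"
    and "0 < s" "0 \<le> t" "t \<le> 2 * s"
  shows "measure_pmf.prob (majority_round n x) {y. color_frac n y i - color_frac n y j < m - t}
           \<le> exp (- (n * t\<^sup>2 / (4 * s)))"
proof -
  let ?g = "\<lambda>v. indicator {i} v - indicator {j} v :: real"
  note int = integrable_measure_pmf_finite[OF finite_set_pmf_node_update[OF n]]
  have sq: "(\<lambda>v. (?g v)\<^sup>2) = (\<lambda>v. indicator {i} v + indicator {j} v)"
    using ij by (auto simp: indicator_def fun_eq_iff)
  have "measure_pmf.prob (majority_round n x)
      {y. (\<Sum>v\<in>{..<n}. ?g (y v)) < card {..<n} * m - n * t}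
      \<le> exp (- (n * t)\<^sup>2 / (4 * card {..<n} * s))"
    unfolding majority_round_def
  proof (rule chernoff_Pi_pmf_lower)
    show "m \<le> measure_pmf.expectation (node_update n x) ?g"
      using assms by (subst Bochner_Integration.integral_diff) (auto intro: int simp: measure_pmf_single)
    show "measure_pmf.expectation (node_update n x) (\<lambda>v. (?g v)\<^sup>2) \<le> s"
      unfolding sq using assms
      by (subst Bochner_Integration.integral_add) (auto intro: int simp: measure_pmf_single)
  qed (use assms in \<open>auto simp: finite_set_pmf_node_update indicator_def\<close>)
  also have "{y. (\<Sum>v\<in>{..<n}. ?g (y v)) < card {..<n} * m - n * t}
      = {y. color_frac n y i - color_frac n y j < m - t}"
    using n by (simp add: color_frac_def color_count_eq_sum_indicator[symmetric] sum_subtractf field_simps)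
  finally show ?thesis using n by (simp add: power2_eq_square mult_ac)
qed

section \<open>Growth of the gap in one round\<close>

text \<open>In expectation the new fraction exceeds \<open>P\<close>, and each new gap exceeds
  \<open>d\<close>, by at least \<open>d * P * (1 - P)\<close>. The Chernoff bounds give up three
  quarters of this drift, and a union bound covers all rivals.\<close>

lemma majority_round_bias_growth:
  fixes n i x d
  defines "P \<equiv> color_frac n x i"
  assumes n: "n > 0" and d: "d > 0" and gap: "\<And>j. j \<noteq> i \<Longrightarrow> P - color_frac n x j \<ge> d"
  shows "measure_pmf.prob (majority_round n x)
      {y. \<not> (P \<le> color_frac n y i \<and>
        (\<forall>j. j \<noteq> i \<longrightarrow> color_frac n y i - color_frac n y j \<ge> d * (1 + P * (1 - P) / 4)))}
      \<le> n * exp (- (9 / 160 * n * d\<^sup>2 * P * (1 - P)\<^sup>2))"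
proof -
  let ?M = "majority_round n x" and ?N = "node_update n x" and ?q = "agree n x"
  define t where "t = 3 / 4 * d * P * (1 - P)"
  \<comment> \<open>Each of the two color probabilities is at most \<open>5 / 4 * P\<close>, so
    \<open>s\<close> bounds their sum.\<close>
  define s where "s = 5 / 2 * P"
  have Pd: "d \<le> P" using gap[of "Suc i"] color_frac_nonneg[of n x "Suc i"] by simp
  then have P: "0 < P" "P \<le> 1" using d color_frac_le_1 by (auto simp: P_def)
  have dP: "d * P * (1 - P) \<le> P * 1 * 1" using P Pd d by (simp add: mult_le_one mult_left_le)
  have q1: "?q \<le> P - d * (1 - P)"
    using agree_le[OF n, of i x "P - d"] gap by (simp add: P_def algebra_simps power2_eq_square)
  have q2: "P\<^sup>2 \<le> ?q" unfolding P_def by (rule agree_ge)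
  have Ni: "pmf ?N i = P * (1 + P - ?q)" unfolding P_def by (rule pmf_node_update[OF n])
  have Ni_le: "pmf ?N i \<le> 5 / 4 * P"
  proof -
    have "P - ?q \<le> 1 / 4 - (P - 1 / 2)\<^sup>2" using q2 by (simp add: power2_eq_square algebra_simps)
    then have "1 + P - ?q \<le> 5 / 4" using zero_le_power2[of "P - 1/2"] by linarith
    from mult_left_mono[OF this, of P] P show ?thesis by (simp add: Ni mult.commute)
  qed
  have Ni_ge: "pmf ?N i \<ge> P * (1 + d * (1 - P))"
    unfolding Ni using P q1 by (intro mult_left_mono) auto
  have diff: "pmf ?N i - pmf ?N j \<ge> d * (1 + P * (1 - P))" "pmf ?N j \<le> pmf ?N i" if j: "j \<noteq> i" for j
  proof -
    define r where "r = color_frac n x j"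
    have r: "0 \<le> r" "r \<le> P - d" using gap[OF j] by (auto simp: r_def color_frac_nonneg)
    have Nj: "pmf ?N j = r * (1 + r - ?q)" unfolding r_def by (rule pmf_node_update[OF n])
    \<comment> \<open>Since \<open>?q\<close> is at most 1, the left side increases with
      \<open>r\<close>, so the worst rival has fraction \<open>P - d\<close>.\<close>
    have "r * (1 + r - ?q) \<le> (P - d) * (1 + (P - d) - ?q)"
      using r agree_le_1[OF n, of x] by (intro mult_mono) auto
    moreover have "P * (1 + P - ?q) - (P - d) * (1 + (P - d) - ?q) = d * (1 + 2 * P - d - ?q)"
      by (simp add: algebra_simps)
    moreover have "d * (1 + 2 * P - d - ?q) \<ge> d * (1 + P * (1 - P))"
    proof (intro mult_left_mono)
      have "d * P \<le> P * P" using Pd P by (intro mult_right_mono) auto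
      then show "1 + P * (1 - P) \<le> 1 + 2 * P - d - ?q" using q1 by (simp add: algebra_simps)
    qed (use d in auto)
    ultimately show "pmf ?N i - pmf ?N j \<ge> d * (1 + P * (1 - P))" unfolding Ni Nj by linarith
    moreover have "d * (1 + P * (1 - P)) \<ge> 0" using d P by simp
    ultimately show "pmf ?N j \<le> pmf ?N i" by linarith
  qed
  have ts: "0 < s" "0 \<le> t" "t \<le> 2 * s" using d P dP by (auto simp: t_def s_def)
  let ?e = "exp (- (n * t\<^sup>2 / (4 * s)))"
  let ?A = "{y. color_frac n y i < P * (1 + d * (1 - P)) - t}"
  let ?B = "\<lambda>j. {y. color_frac n y i - color_frac n y j < d * (1 + P * (1 - P)) - t}"
  let ?J = "x ` {..<n} - {i}"
  have A: "measure_pmf.prob ?M ?A \<le> ?e"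
    by (rule prob_color_frac_less[OF n]) (use ts Ni_ge Ni_le P in \<open>auto simp: s_def\<close>)
  have B: "measure_pmf.prob ?M (?B j) \<le> ?e" if "j \<in> ?J" for j
  proof -
    have j: "j \<noteq> i" using that by auto
    show ?thesis
      by (rule prob_color_frac_diff_less[OF n]) (use j diff[OF j] ts Ni_le in \<open>auto simp: s_def\<close>)
  qed
  have tA: "P * (1 + d * (1 - P)) - t = P + P * d * (1 - P) / 4"
    and tB: "d * (1 + P * (1 - P)) - t = d * (1 + P * (1 - P) / 4)"
    by (auto simp: t_def field_simps)
  have "measure_pmf.prob ?M {y. \<not> (P \<le> color_frac n y i \<and>
        (\<forall>j. j \<noteq> i \<longrightarrow> color_frac n y i - color_frac n y j \<ge> d * (1 + P * (1 - P) / 4)))}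
      \<le> measure_pmf.prob ?M (?A \<union> (\<Union>j\<in>?J. ?B j))"
  \<comment> \<open>The inclusion is only almost sure: off the support, a color outside
    \<open>?J\<close> could appear.\<close>
  proof (rule measure_pmf.finite_measure_mono_AE)
    show "AE y in ?M. y \<in> {y. \<not> (P \<le> color_frac n y i \<and>
        (\<forall>j. j \<noteq> i \<longrightarrow> color_frac n y i - color_frac n y j \<ge> d * (1 + P * (1 - P) / 4)))} \<longrightarrow>
      y \<in> ?A \<union> (\<Union>j\<in>?J. ?B j)"
      unfolding AE_measure_pmf_iff
    proof (intro ballI impI, rule ccontr)
      fix y assume y: "y \<in> set_pmf ?M"
        and bad: "y \<in> {y. \<not> (P \<le> color_frac n y i \<and>
          (\<forall>j. j \<noteq> i \<longrightarrow> color_frac n y i - color_frac n y j \<ge> d * (1 + P * (1 - P) / 4)))}"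
        and good: "y \<notin> ?A \<union> (\<Union>j\<in>?J. ?B j)"
      have g1: "P + P * d * (1 - P) / 4 \<le> color_frac n y i" using good tA by auto
      have g2: "d * (1 + P * (1 - P) / 4) \<le> color_frac n y i - color_frac n y j" if "j \<in> ?J" for j
      proof -
        have "y \<notin> ?B j" using good that by blast
        then show ?thesis using tB by simp
      qed
      have "d * (1 + P * (1 - P) / 4) \<le> color_frac n y i - color_frac n y j" if "j \<noteq> i" for j
      proof (cases "j \<in> ?J")
        \<comment> \<open>Extinct colors stay extinct, so the union bound needs only the at most \<open>n\<close> present colors.\<close>
        case False
        then have "{v. v < n \<and> y v = j} = {}"
          using majority_round_color[OF n y] that by auto
        then have "color_frac n y j = 0" by (simp add: color_frac_def color_count_def)
        then show ?thesis using g1 Pd by (simp add: algebra_simps)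
      qed (rule g2)
      moreover have "P \<le> color_frac n y i"
      proof -
        have "0 \<le> P * d * (1 - P)" using P d by simp
        then show ?thesis using g1 by linarith
      qed
      ultimately show False using bad by auto
    qed
  qed auto
  also have "\<dots> \<le> measure_pmf.prob ?M ?A + (\<Sum>j\<in>?J. measure_pmf.prob ?M (?B j))"
    by (intro order.trans[OF measure_Un_le] add_left_mono measure_UNION_le) auto
  also have "\<dots> \<le> ?e + card ?J * ?e"
    using sum_mono[of ?J "\<lambda>j. measure_pmf.prob ?M (?B j)" "\<lambda>_. ?e"] A B by auto
  also have "\<dots> = (1 + card ?J) * ?e" by (simp add: algebra_simps)
  also have "\<dots> \<le> n * ?e"
  proof (intro mult_right_mono)
    \<comment> \<open>Color \<open>i\<close> is present, so \<open>?J\<close> has fewer than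
      \<open>n\<close> elements and the event \<open>?A\<close> still fits into the factor
      \<open>n\<close>.\<close>
    have "i \<in> x ` {..<n}"
    proof -
      have "{v. v < n \<and> x v = i} \<noteq> {}" using P unfolding P_def color_frac_def color_count_def
        by (metis card.empty div_0 less_irrefl of_nat_0)
      then show ?thesis by auto
    qed
    then have "?J \<subset> x ` {..<n}" by auto
    then have "card ?J < card (x ` {..<n})" by (intro psubset_card_mono) auto
    also have "\<dots> \<le> n" using card_image_le[of "{..<n}" x] by simp
    finally show "real (1 + card ?J) \<le> n" by simp
  qed auto
  also have "n * t\<^sup>2 / (4 * s) = 9 / 160 * n * d\<^sup>2 * P * (1 - P)\<^sup>2"
    using P by (simp add: t_def s_def field_simps power2_eq_square)
  finally show ?thesis .
qed

section \<open>Drift once the plurality color holds two thirds of the nodes\<close>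

text \<open>With \<open>P\<close> for the fraction of color \<open>i\<close>, no rival exceeds
  \<open>1 - P\<close>, which bounds the agreement. The resulting factor
  \<open>1 + P - 2 * P\<^sup>2\<close> equals 7/9 at \<open>P = 2 / 3\<close> and decreases from
  there on.\<close>

lemma pmf_node_update_dominant:
  assumes n: "n > 0" and P: "color_frac n x i \<ge> 2 / 3"
  shows "1 - pmf (node_update n x) i \<le> 7 / 9 * (1 - color_frac n x i)"
proof -
  let ?P = "color_frac n x i"
  have P1: "?P \<le> 1" by (rule color_frac_le_1)
  have q: "agree n x \<le> ?P\<^sup>2 + (1 - ?P) * (1 - ?P)"
    by (rule agree_le[OF n]) (use color_frac_add_le[of i _ n x] in \<open>auto simp: algebra_simps\<close>)
  have "1 - pmf (node_update n x) i = 1 - ?P * (1 + ?P - agree n x)"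
    by (simp add: pmf_node_update[OF n])
  also have "\<dots> \<le> 1 - ?P * (1 + ?P - (?P\<^sup>2 + (1 - ?P) * (1 - ?P)))"
    using q P by (intro diff_left_mono mult_left_mono) auto
  also have "\<dots> = (1 + ?P - 2 * ?P\<^sup>2) * (1 - ?P)"
    by (simp add: algebra_simps power2_eq_square)
  also have "\<dots> \<le> 7 / 9 * (1 - ?P)"
  proof (intro mult_right_mono)
    have "0 \<le> (?P - 2 / 3) * (2 * ?P + 1 / 3)" using P by simp
    then show "1 + ?P - 2 * ?P\<^sup>2 \<le> 7 / 9" by (simp add: algebra_simps power2_eq_square)
  qed (use P1 in auto)
  finally show ?thesis .
qed

lemma expectation_color_frac_majority_round:
  assumes n: "n > 0"
  shows "measure_pmf.expectation (majority_round n x) (\<lambda>y. color_frac n y i) = pmf (node_update n x) i"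
proof -
  note int = integrable_measure_pmf_finite[OF finite_set_pmf_majority_round]
  have one: "measure_pmf.expectation (majority_round n x) (\<lambda>y. indicator {i} (y v))
      = pmf (node_update n x) i" if "v < n" for v
  proof -
    have "measure_pmf.expectation (majority_round n x) (\<lambda>y. indicator {i} (y v) :: real)
       = measure_pmf.expectation (map_pmf (\<lambda>y. y v) (majority_round n x)) (indicator {i})"
      by (rule integral_map_pmf[symmetric])
    also have "map_pmf (\<lambda>y. y v) (majority_round n x) = node_update n x"
      using that by (simp add: majority_round_def Pi_pmf_component)
    finally show ?thesis by (simp add: measure_pmf_single)
  qed
  have "measure_pmf.expectation (majority_round n x) (\<lambda>y. color_frac n y i)
     = (\<Sum>v<n. measure_pmf.expectation (majority_round n x) (\<lambda>y. indicator {i} (y v))) / n"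
    unfolding color_frac_def color_count_eq_sum_indicator
    by (simp add: Bochner_Integration.integral_sum int)
  also have "\<dots> = pmf (node_update n x) i" using n by (simp add: one)
  finally show ?thesis .
qed

text \<open>The expected fraction is at least \<open>1 - 7 / 9 * (1 / 3) = 20 / 27\<close>, so
  leaving requires a deviation of \<open>2 / 27\<close>.\<close>

lemma prob_leave_dominant:
  assumes n: "n > 0" and P: "color_frac n x i \<ge> 2 / 3"
  shows "measure_pmf.prob (majority_round n x) {y. color_frac n y i < 2 / 3} \<le> exp (- (n / 729))"
proof -
  have "measure_pmf.prob (majority_round n x) {y. color_frac n y i < 20 / 27 - 2 / 27}
      \<le> exp (- (n * (2 / 27)\<^sup>2 / (4 * 1)))"
    by (rule prob_color_frac_less[OF n])
      (use pmf_node_update_dominant[OF assms] P pmf_le_1 in \<open>auto simp: field_simps\<close>)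
  then show ?thesis by (simp add: power2_eq_square)
qed

section \<open>Failure probability over several rounds\<close>

lemma measure_bind_pmf:
  "measure_pmf.prob (bind_pmf M f) A = measure_pmf.expectation M (\<lambda>x. measure_pmf.prob (f x) A)"
proof -
  have "ennreal (measure_pmf.prob (bind_pmf M f) A) = (\<integral>\<^sup>+x. measure_pmf.prob (f x) A \<partial>M)"
    by (simp add: measure_pmf.emeasure_eq_measure[symmetric])
  also have "\<dots> = ennreal (measure_pmf.expectation M (\<lambda>x. measure_pmf.prob (f x) A))"
    by (intro nn_integral_eq_integral measure_pmf.integrable_const_bound[where B = 1]) auto
  finally show ?thesis by (simp add: integral_nonneg_AE)
qed

text \<open>Passing to the complement lets the error probabilities of single rounds add up.\<close>

definition fail_prob :: "nat \<Rightarrow> nat \<Rightarrow> nat \<Rightarrow> (nat \<Rightarrow> nat) \<Rightarrow> real" where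
  "fail_prob n j T x = 1 - prob_reach_within n j T x"

lemma fail_prob_0: "fail_prob n j 0 x = of_bool (\<not> all_color n j x)"
  by (simp add: fail_prob_def prob_reach_within_def indicator_def)

text \<open>First-step analysis: a trajectory begins with \<open>x\<close> itself, so time 0 is
  decided by \<open>x\<close>, and all later times by a trajectory from the next coloring.\<close>

lemma fail_prob_Suc:
  "fail_prob n j (Suc T) x = (if all_color n j x then 0
     else measure_pmf.expectation (majority_round n x) (fail_prob n j T))"
proof -
  have *: "{xs. \<exists>t\<le>Suc T. all_color n j ((x # xs) ! t)}
      = (if all_color n j x then UNIV else {xs. \<exists>t\<le>T. all_color n j (xs ! t)})"
  proof -
    have "(\<exists>t\<le>Suc T. Q t) \<longleftrightarrow> Q 0 \<or> (\<exists>t\<le>T. Q (Suc t))" for Q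
      by (metis Suc_le_mono le0 not0_implies_Suc)
    then show ?thesis by auto
  qed
  have "prob_reach_within n j (Suc T) x = (if all_color n j x then 1
     else measure_pmf.expectation (majority_round n x) (prob_reach_within n j T))"
    by (simp add: prob_reach_within_def measure_bind_pmf * prob_reach_within_def[abs_def])
  then show ?thesis
    by (simp add: fail_prob_def fail_prob_def[abs_def]
      integrable_measure_pmf_finite[OF finite_set_pmf_majority_round])
qed

lemma fail_prob_bounds: "0 \<le> fail_prob n j T x" "fail_prob n j T x \<le> 1"
  by (auto simp: fail_prob_def prob_reach_within_def)

lemma fail_prob_Suc_le:
  "fail_prob n j (Suc T) x \<le> measure_pmf.expectation (majority_round n x) (fail_prob n j T)"
  by (auto simp: fail_prob_Suc fail_prob_bounds intro!: integral_nonneg_AE)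

lemma fail_prob_antimono:
  assumes "S \<le> T"
  shows "fail_prob n j T x \<le> fail_prob n j S x"
proof -
  have step: "fail_prob n j (Suc T) x \<le> fail_prob n j T x" for T x
  proof (induction T arbitrary: x)
    case 0
    then show ?case by (auto simp: fail_prob_0 fail_prob_bounds) (simp add: fail_prob_Suc)
  next
    case (Suc T)
    then show ?case unfolding fail_prob_Suc[of n j "Suc T" x] fail_prob_Suc[of n j T x]
      by (auto intro!: integral_mono integrable_measure_pmf_finite[OF finite_set_pmf_majority_round])
  qed
  show ?thesis using lift_Suc_antimono_le[of "\<lambda>T. fail_prob n j T x"] step assms by blast
qed

text \<open>On the bad event \<open>B\<close> failure is bounded by 1, at a total cost of
  \<open>\<delta>\<close>; elsewhere \<open>h\<close> applies.\<close>

lemma fail_prob_step: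
  assumes "measure_pmf.prob (majority_round n x) B \<le> \<delta>"
    and "\<And>y. y \<notin> B \<Longrightarrow> fail_prob n j T y \<le> h y" and "\<And>y. 0 \<le> h y"
  shows "fail_prob n j (Suc T) x \<le> measure_pmf.expectation (majority_round n x) h + \<delta>"
proof -
  note int = integrable_measure_pmf_finite[OF finite_set_pmf_majority_round]
  have "fail_prob n j (Suc T) x \<le> measure_pmf.expectation (majority_round n x) (fail_prob n j T)"
    by (rule fail_prob_Suc_le)
  also have "\<dots> \<le> measure_pmf.expectation (majority_round n x) (\<lambda>y. h y + indicator B y)"
  proof (intro integral_mono int)
    fix y show "fail_prob n j T y \<le> h y + indicator B y"
      using assms(2,3)[of y] fail_prob_bounds(2)[of n j T y] by (cases "y \<in> B") auto
  qed
  also have "\<dots> = measure_pmf.expectation (majority_round n x) h + measure_pmf.prob (majority_round n x) B"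
    by (simp add: int)
  finally show ?thesis using assms(1) by linarith
qed

section \<open>The two phases\<close>

text \<open>Markov's inequality in recursive form: the expected number of nodes without color
  \<open>i\<close> shrinks by 7/9 per round, and the risk of leaving the region adds one exponential
  term per round.\<close>

lemma fail_prob_dominant:
  assumes n: "n > 0" and P: "color_frac n x i \<ge> 2 / 3"
  shows "fail_prob n i T x \<le> n * (1 - color_frac n x i) * (7 / 9) ^ T + T * exp (- (n / 729))"
  using P
proof (induction T arbitrary: x)
  case 0
  \<comment> \<open>The number of nodes without color \<open>i\<close> is an integer, hence it
    dominates the indicator of failure.\<close>
  have "1 \<le> n * (1 - color_frac n x i)" if mixed: "\<not> all_color n i x"
  proof -
    obtain w where w: "w < n" "x w \<noteq> i" using mixed unfolding all_color_def by blast
    then have "{v. v < n \<and> x v = i} \<subset> {..<n}" by auto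
    then have "color_count n x i < n"
      using psubset_card_mono[of "{..<n}" "{v. v < n \<and> x v = i}"] by (simp add: color_count_def)
    then show ?thesis using n by (simp add: color_frac_def algebra_simps)
  qed
  then show ?case using color_frac_le_1[of n x i] by (auto simp: fail_prob_0)
next
  case (Suc T)
  let ?e = "exp (- (real n / 729))"
  let ?h = "\<lambda>y. n * (1 - color_frac n y i) * (7 / 9) ^ T + T * ?e"
  have "fail_prob n i (Suc T) x \<le> measure_pmf.expectation (majority_round n x) ?h + ?e"
    by (rule fail_prob_step[OF prob_leave_dominant[OF n Suc.prems]])
      (use Suc.IH color_frac_le_1 in \<open>auto simp: not_less intro!: add_nonneg_nonneg mult_nonneg_nonneg\<close>)
  \<comment> \<open>\<open>?h\<close> is affine in the fraction of color \<open>i\<close>, so only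
    the law of one node enters.\<close>
  also have "measure_pmf.expectation (majority_round n x) ?h
      = n * (1 - pmf (node_update n x) i) * (7 / 9) ^ T + T * ?e"
    using n by (simp add: expectation_color_frac_majority_round
        integrable_measure_pmf_finite[OF finite_set_pmf_majority_round])
  also have "\<dots> \<le> n * (7 / 9 * (1 - color_frac n x i)) * (7 / 9) ^ T + T * ?e"
    by (intro add_right_mono mult_right_mono mult_left_mono pmf_node_update_dominant[OF n Suc.prems]) auto
  finally show ?case by (simp add: algebra_simps)
qed

text \<open>Induction on the budget \<open>S\<close> of the first phase, for varying
  \<open>d\<close>: each round moves one factor \<open>1 + P\<^sub>0 / 12\<close> from the power
  into the gap. Once the fraction reaches 2/3, the bound for the second phase takes over. Fixed
  \<open>d\<^sub>0\<close> and \<open>P\<^sub>0\<close> give all rounds the same error term.\<close>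

lemma fail_prob_biased:
  assumes n: "n > 0" and d0: "d\<^sub>0 > 0" and P0: "P\<^sub>0 > 0"
  assumes "d \<ge> d\<^sub>0" "color_frac n x i \<ge> P\<^sub>0"
    and "\<And>j. j \<noteq> i \<Longrightarrow> color_frac n x i - color_frac n x j \<ge> d"
    and "d * (1 + P\<^sub>0 / 12) ^ S > 1"
  shows "fail_prob n i (S + T) x \<le> S * (n * exp (- (1 / 160 * n * d\<^sub>0\<^sup>2 * P\<^sub>0)))
     + (n * (7 / 9) ^ T + T * exp (- (n / 729)))"
  using assms(4-)
proof (induction S arbitrary: d x)
  case (0 d x)
  \<comment> \<open>With no rounds left the growth hypothesis says \<open>d > 1\<close>, but a gap
    is at most 1.\<close>
  have "d \<le> color_frac n x i"
    using 0(3)[of "Suc i"] color_frac_nonneg[of n x "Suc i"] by simp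
  with 0 color_frac_le_1[of n x i] show ?case by simp
next
  case (Suc S d x)
  let ?P = "color_frac n x i"
  let ?E = "n * exp (- (1 / 160 * n * d\<^sub>0\<^sup>2 * P\<^sub>0))"
  let ?R = "n * (7 / 9) ^ T + T * exp (- (real n / 729))"
  have P1: "?P \<le> 1" by (rule color_frac_le_1)
  show ?case
  proof (cases "?P \<ge> 2 / 3")
    case True
    have "fail_prob n i (Suc S + T) x \<le> fail_prob n i T x" by (rule fail_prob_antimono) simp
    also have "\<dots> \<le> n * (1 - ?P) * (7 / 9) ^ T + T * exp (- (real n / 729))"
      by (rule fail_prob_dominant[OF n True])
    also have "\<dots> \<le> ?R"
      using color_frac_nonneg[of n x i] by (intro add_right_mono mult_right_mono) (auto simp: mult_left_le)
    also have "\<dots> \<le> Suc S * ?E + ?R" by simp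
    finally show ?thesis .
  next
    case False
    let ?d = "d * (1 + ?P * (1 - ?P) / 4)"
    let ?B = "{y. \<not> (?P \<le> color_frac n y i \<and>
        (\<forall>j. j \<noteq> i \<longrightarrow> color_frac n y i - color_frac n y j \<ge> ?d))}"
    have d: "d > 0" using Suc.prems(1) d0 by simp
    \<comment> \<open>Below 2/3 the factor \<open>1 - ?P\<close> is at least 1/3.\<close>
    have grow: "1 + P\<^sub>0 / 12 \<le> 1 + ?P * (1 - ?P) / 4"
      using mult_mono[OF Suc.prems(2), of "1 / 3" "1 - ?P"] False P0 Suc.prems(2) by simp
    have "measure_pmf.prob (majority_round n x) ?B
        \<le> n * exp (- (9 / 160 * n * d\<^sup>2 * ?P * (1 - ?P)\<^sup>2))"
      by (rule majority_round_bias_growth[OF n d Suc.prems(3)])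
    also have "\<dots> \<le> ?E"
    proof -
      \<comment> \<open>The same bound 1/3 enters squared and turns 9/160 into 1/160.\<close>
      have "(1 / 160 * n * d\<^sub>0\<^sup>2 * P\<^sub>0) = 9 / 160 * n * d\<^sub>0\<^sup>2 * P\<^sub>0 * (1 / 3)\<^sup>2" by (simp add: power2_eq_square)
      also have "\<dots> \<le> 9 / 160 * n * d\<^sup>2 * ?P * (1 - ?P)\<^sup>2"
        using False Suc.prems d0 P0 by (intro mult_mono power_mono) auto
      finally show ?thesis by (intro mult_left_mono) auto
    qed
    finally have B: "measure_pmf.prob (majority_round n x) ?B \<le> ?E" .
    have "fail_prob n i (Suc (S + T)) x
        \<le> measure_pmf.expectation (majority_round n x) (\<lambda>_. S * ?E + ?R) + ?E"
    proof (rule fail_prob_step[OF B])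
      fix y assume y: "y \<notin> ?B"
      show "fail_prob n i (S + T) y \<le> S * ?E + ?R"
      proof (rule Suc.IH)
        have "d * 1 \<le> ?d" using d P1 color_frac_nonneg[of n x i] by (intro mult_left_mono) auto
        then show "d\<^sub>0 \<le> ?d" using Suc.prems(1) by linarith
        show "P\<^sub>0 \<le> color_frac n y i" using y Suc.prems(2) by auto
        show "?d \<le> color_frac n y i - color_frac n y j" if "j \<noteq> i" for j using y that by auto
        have "1 < d * (1 + P\<^sub>0 / 12) * (1 + P\<^sub>0 / 12) ^ S" using Suc.prems(4) by (simp add: mult.assoc)
        also have "\<dots> \<le> ?d * (1 + P\<^sub>0 / 12) ^ S"
          using grow d P0 by (intro mult_right_mono mult_left_mono) auto
        finally show "1 < ?d * (1 + P\<^sub>0 / 12) ^ S" .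
      qed
    qed (auto intro!: add_nonneg_nonneg)
    then show ?thesis by (simp add: algebra_simps)
  qed
qed


section \<open>Choice of the constants\<close>

theorem corollary3p3:
  fixes l :: real
  shows "\<exists>(C::real) (\<gamma>::real) (n\<^sub>0::nat). C > 0 \<and> \<gamma> > 0 \<and>
    (\<forall>n\<ge>n\<^sub>0. \<forall>(k::nat) (c::nat \<Rightarrow> nat) (x::nat \<Rightarrow> nat).
       configuration k n c \<longrightarrow> color_sorted k c \<longrightarrow>
       real (c 1) \<ge> real n / ln (real n) powr l \<longrightarrow>
       real_of_int (bias c) \<ge> 22 * sqrt (real n * ln (real n) powr (l + 1)) \<longrightarrow>
       color_count n x = c \<longrightarrow>
       prob_reach_within n 1 (nat \<lfloor>C * ln (real n) powr (l + 1)\<rfloor>) x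
         \<ge> 1 - real n powr (- \<gamma>))"
proof -
  have "eventually (\<lambda>n::nat. ln (real n) > 1) sequentially" by real_asymp
  \<comment> \<open>Up to powers of \<open>ln n\<close>, the three terms are
    \<open>1 / n\<^sup>2\<close>, \<open>1 / n\<close> and exponentially small.\<close>
  moreover have "eventually (\<lambda>n::nat. 13 * ln (real n) powr (l + 1) * (n * exp (- (3 * ln (real n))))
      + (n * exp (- (2 * ln (real n))) + 11 * ln (real n) powr (l + 1) * exp (- (real n / 729)))
      \<le> real n powr (- (1 / 2))) sequentially"
    by real_asymp
  ultimately have "eventually (\<lambda>n::nat. ln (real n) > 1 \<and>
      13 * ln (real n) powr (l + 1) * (n * exp (- (3 * ln (real n))))
      + (n * exp (- (2 * ln (real n))) + 11 * ln (real n) powr (l + 1) * exp (- (real n / 729)))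
      \<le> real n powr (- (1 / 2))) sequentially"
    by (rule eventually_conj)
  then obtain n\<^sub>0 where n\<^sub>0: "\<And>n. n \<ge> n\<^sub>0 \<Longrightarrow> ln (real n) > 1 \<and>
      13 * ln (real n) powr (l + 1) * (n * exp (- (3 * ln (real n))))
      + (n * exp (- (2 * ln (real n))) + 11 * ln (real n) powr (l + 1) * exp (- (real n / 729)))
      \<le> real n powr (- (1 / 2))"
    unfolding eventually_sequentially by blast
  have "prob_reach_within n 1 (nat \<lfloor>30 * ln (real n) powr (l + 1)\<rfloor>) x \<ge> 1 - real n powr (- (1 / 2))"
    if "n \<ge> n\<^sub>0" and conf: "configuration k n c" and sorted: "color_sorted k c"
      and c1: "real (c 1) \<ge> real n / ln (real n) powr l"
      and bias: "real_of_int (bias c) \<ge> 22 * sqrt (real n * ln (real n) powr (l + 1))"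
      and x: "color_count n x = c"
    for n k c x
  proof -
    define L where "L = ln (real n)"
    define M where "M = L powr (l + 1)"
    define P\<^sub>0 where "P\<^sub>0 = L powr (- l)"
    \<comment> \<open>This is the assumed bias divided by \<open>n\<close>.\<close>
    define d\<^sub>0 where "d\<^sub>0 = 22 * sqrt (M / n)"
    define T\<^sub>1 where "T\<^sub>1 = nat \<lceil>12 * M\<rceil>"
    define T\<^sub>2 where "T\<^sub>2 = nat \<lceil>10 * L\<rceil>"
    have L: "L > 1" using n\<^sub>0[OF \<open>n \<ge> n\<^sub>0\<close>] by (simp add: L_def)
    then have n: "n > 0" by (cases "n = 0") (auto simp: L_def)
    have P: "color_frac n x 1 \<ge> P\<^sub>0"
      using divide_right_mono[OF c1, of n] n L
      by (simp add: color_frac_def x P\<^sub>0_def powr_minus L_def divide_simps)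
    \<comment> \<open>For negative \<open>l\<close> the required fraction \<open>P\<^sub>0\<close>
      would exceed 1, so no configuration qualifies.\<close>
    have l: "l \<ge> 0"
    proof (rule ccontr)
      assume "\<not> l \<ge> 0"
      then have "1 < P\<^sub>0" using L by (simp add: P\<^sub>0_def)
      then show False using P color_frac_le_1[of n x 1] by simp
    qed
    have P\<^sub>0: "0 < P\<^sub>0" "P\<^sub>0 \<le> 1"
      using L l powr_mono[of "- l" 0 L] by (auto simp: P\<^sub>0_def)
    have M: "L \<le> M" using L l powr_mono[of 1 "l + 1" L] by (auto simp: M_def)
    have MP: "M * P\<^sub>0 = L" using L by (simp add: M_def P\<^sub>0_def powr_add[symmetric])
    have d\<^sub>0: "d\<^sub>0 > 0" using L M n by (simp add: d\<^sub>0_def)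
    have gap: "color_frac n x 1 - color_frac n x j \<ge> d\<^sub>0" if j: "j \<noteq> 1" for j
    proof -
      \<comment> \<open>Colors outside \<open>{1..k}\<close> are covered too, since their counts
        vanish.\<close>
      have "c j \<le> c 2"
      proof (cases "j \<in> {1..k}")
        case True
        then show ?thesis using sorted j by (auto simp: color_sorted_def)
      next
        case False
        then show ?thesis using conf by (simp add: configuration_def)
      qed
      then have "22 * sqrt (n * M) \<le> real (c 1) - real (c j)"
        using bias by (simp add: bias_def M_def L_def)
      moreover have "22 * sqrt (n * M) = n * d\<^sub>0"
        using n by (simp add: d\<^sub>0_def real_sqrt_mult real_sqrt_divide field_simps)
      ultimately show ?thesis using n by (simp add: color_frac_def x field_simps)
    qed
    \<comment> \<open>As \<open>M * P\<^sub>0 = L\<close>, growth by at least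
      \<open>exp (P\<^sub>0 / 24)\<close> per round gives the factor \<open>sqrt n\<close> after
      \<open>12 * M\<close> rounds, and \<open>d\<^sub>0 * sqrt n = 22 * sqrt M\<close> exceeds
      1.\<close>
    have growth: "d\<^sub>0 * (1 + P\<^sub>0 / 12) ^ T\<^sub>1 > 1"
    proof -
      have "sqrt n = exp (1 / 2 * L)"
        using n by (simp add: L_def powr_half_sqrt[symmetric] powr_def)
      also have "\<dots> = exp (12 * M * (P\<^sub>0 / 24))" using MP by (simp add: mult.assoc)
      also have "\<dots> \<le> exp (T\<^sub>1 * (P\<^sub>0 / 24))"
        using P\<^sub>0 by (simp add: T\<^sub>1_def mult_right_mono real_nat_ceiling_ge)
      also have "\<dots> = exp (P\<^sub>0 / 24) ^ T\<^sub>1" by (rule exp_of_nat_mult)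
      also have "\<dots> \<le> (1 + P\<^sub>0 / 12) ^ T\<^sub>1"
      proof (intro power_mono)
        have "P\<^sub>0\<^sup>2 \<le> P\<^sub>0" using P\<^sub>0 by (simp add: power2_eq_square mult_left_le)
        then show "exp (P\<^sub>0 / 24) \<le> 1 + P\<^sub>0 / 12"
          using exp_le_quadratic[of "P\<^sub>0 / 24"] P\<^sub>0 by (simp add: power_divide)
      qed auto
      finally have "d\<^sub>0 * sqrt n \<le> d\<^sub>0 * (1 + P\<^sub>0 / 12) ^ T\<^sub>1" using d\<^sub>0 by simp
      moreover have "d\<^sub>0 * sqrt n = 22 * sqrt M" using n by (simp add: d\<^sub>0_def real_sqrt_divide)
      moreover have "1 \<le> sqrt M" using L M by simp
      ultimately show ?thesis by linarith
    qed
    \<comment> \<open>Each ceiling costs at most one round, which \<open>M\<close> absorbs because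
      \<open>1 < L \<le> M\<close>.\<close>
    have T\<^sub>1: "T\<^sub>1 \<le> 13 * M" and T\<^sub>2: "T\<^sub>2 \<le> 11 * M"
      using L M unfolding T\<^sub>1_def T\<^sub>2_def by linarith+
    have T: "T\<^sub>1 + T\<^sub>2 \<le> nat \<lfloor>30 * M\<rfloor>" using T\<^sub>1 T\<^sub>2 L M by (intro le_nat_floor) simp
    \<comment> \<open>Since \<open>exp (1 / 5) \<le> 31 / 25 < 9 / 7\<close>, the
      \<open>10 * L\<close> rounds of the second phase contract by \<open>exp (- (2 * L))\<close>,
      which beats the factor \<open>n\<close>.\<close>
    have "(7 / 9 :: real) ^ T\<^sub>2 \<le> exp (- (1 / 5)) ^ T\<^sub>2"
    proof (intro power_mono)
      show "7 / 9 \<le> exp (- (1 / 5) :: real)"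
        using exp_le_quadratic[of "1 / 5"] by (simp add: exp_minus power2_eq_square divide_simps)
    qed auto
    also have "\<dots> = exp (- (T\<^sub>2 / 5))" by (simp add: exp_of_nat_mult[symmetric])
    also have "\<dots> \<le> exp (- (2 * L))" unfolding T\<^sub>2_def by simp linarith
    finally have contraction: "(7 / 9 :: real) ^ T\<^sub>2 \<le> exp (- (2 * L))" .
    \<comment> \<open>The constant 22 enters here: its square 484 exceeds \<open>3 * 160\<close>, so
      the error of a round is at most \<open>n * exp (- (3 * L))\<close>.\<close>
    have "1 / 160 * n * d\<^sub>0\<^sup>2 * P\<^sub>0 = 484 / 160 * (M * P\<^sub>0)"
      using n L M by (simp add: d\<^sub>0_def power_mult_distrib)
    then have "3 * L \<le> 1 / 160 * n * d\<^sub>0\<^sup>2 * P\<^sub>0" unfolding MP using L by linarith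
    then have noise: "exp (- (1 / 160 * n * d\<^sub>0\<^sup>2 * P\<^sub>0)) \<le> exp (- (3 * L))"
      by (simp only: exp_le_cancel_iff neg_le_iff_le)
    have "fail_prob n 1 (nat \<lfloor>30 * M\<rfloor>) x \<le> fail_prob n 1 (T\<^sub>1 + T\<^sub>2) x"
      by (rule fail_prob_antimono[OF T])
    also have "\<dots> \<le> T\<^sub>1 * (n * exp (- (1 / 160 * n * d\<^sub>0\<^sup>2 * P\<^sub>0)))
        + (n * (7 / 9) ^ T\<^sub>2 + T\<^sub>2 * exp (- (n / 729)))"
      by (rule fail_prob_biased[OF n d\<^sub>0 P\<^sub>0(1) order_refl P gap growth])
    also have "\<dots> \<le> 13 * M * (n * exp (- (3 * L)))
        + (n * exp (- (2 * L)) + 11 * M * exp (- (n / 729)))"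
      using T\<^sub>1 T\<^sub>2 contraction noise L M
      by (intro add_mono mult_mono mult_left_mono mult_right_mono) auto
    also have "\<dots> \<le> real n powr (- (1 / 2))"
      using n\<^sub>0[OF \<open>n \<ge> n\<^sub>0\<close>] by (simp add: L_def M_def)
    finally show ?thesis by (simp add: fail_prob_def M_def L_def)
  qed
  then show ?thesis
    by (intro exI[of _ 30] exI[of _ "1 / 2"] exI[of _ n\<^sub>0]) auto
qed

end
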